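(* Let $\mathbb{L}=(\mathcal{P},\mathcal{C},-)$ be a Laguerre plane, $p$ a point and $K$ a circle with $p\in K$. Let $\Delta=\Delta(p,K)$ be a group of automorphisms of $\mathbb{L}$ that maps the pencil $\langle p,K\rangle$ onto itself and fixes every point of the generator $\overline{p}$, and suppose that (i) $\Delta$ is transitive on $\mathcal{P}\setminus\overline{p}$; (ii) for every $r\in K\setminus\{p\}$ and all $x,y\in K\setminus\{p,r\}$ there is $\sigma\in\Delta_r$ with $\sigma(x)=y$; (iii) for every circle $M$ with $p\notin M$ there is exactly one circle of $\langle p,K\rangle$ tangent to $M$. Let $q\neq p$ be a point parallel to $p$ and let $x$ be a point not parallel to $p$. Then the points of tangency of circles of the pencil $\langle p,K\rangle$ with circles of the pencil $\langle x,q\rangle$ form a circle without its point on the generator $\overline{p}$; that is, there is a circle $Q$ such that the set of all points $y$ for which there exist $P\in\langle p,K\rangle$ and $N\in\langle x,q\rangle$ with $P\cap N=\{y\}$ equals $Q\setminus\overline{p}$.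
   Context: A Laguerre plane is a structure $\mathbb{L}=(\mathcal{P},\mathcal{C},-)$ with a set $\mathcal{P}$ of points, a set $\mathcal{C}\subset 2^{\mathcal{P}}$ of circles and an equivalence relation $-$ on $\mathcal{P}$ (parallelity of points), whose classes are called generators; $\overline{p}$ is the generator containing $p$. Axioms: (1) three pairwise nonparallel points lie on a unique circle; (2) for every circle $K$ and nonparallel points $p\in K$, $q\notin K$ there is exactly one circle $L$ through $q$ with $K\cap L=\{p\}$; (3) for any point $p$ and circle $K$ there is exactly one point $q\in K$ with $p-q$; (4) some circle contains at least three points but not all points. Automorphisms are permutations of $\mathcal{P}$ mapping circles to circles and generators to generators. Two circles are tangent (in $p$) if their intersection is a single point ($\{p\}$). For $p\in K$, $\langle p,K\rangle$ is the set consisting of $K$ and all circles tangent to $K$ in $p$. For nonparallel points $x,q$, $\langle x,q\rangle$ is the set of all circles containing both $x$ and $q$. $\Delta_r$ is the stabilizer of $r$ in $\Delta$. *)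

theory Defs
  imports "HOL-Algebra.Bij"
begin

locale laguerre_plane =
  fixes \<P> :: "'a set" and \<C> :: "'a set set" and par :: "'a rel"
  assumes equiv_par: "equiv \<P> par"
    and circle_subset: "K \<in> \<C> \<Longrightarrow> K \<subseteq> \<P>"
    and joining: "\<lbrakk>a \<in> \<P>; b \<in> \<P>; c \<in> \<P>; (a, b) \<notin> par; (b, c) \<notin> par; (a, c) \<notin> par\<rbrakk>
      \<Longrightarrow> \<exists>!K. K \<in> \<C> \<and> {a, b, c} \<subseteq> K"
    and touching: "\<lbrakk>K \<in> \<C>; p \<in> K; q \<in> \<P> - K; (p, q) \<notin> par\<rbrakk>
      \<Longrightarrow> \<exists>!L. L \<in> \<C> \<and> q \<in> L \<and> K \<inter> L = {p}"
    and parallel_projection: "\<lbrakk>p \<in> \<P>; K \<in> \<C>\<rbrakk> \<Longrightarrow> \<exists>!q. q \<in> K \<and> (p, q) \<in> par"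
    and rich: "\<exists>K\<in>\<C>. (\<exists>a\<in>K. \<exists>b\<in>K. \<exists>c\<in>K. a \<noteq> b \<and> b \<noteq> c \<and> a \<noteq> c) \<and> K \<noteq> \<P>"

definition generator :: "'a rel \<Rightarrow> 'a \<Rightarrow> 'a set"
  where "generator par p = par `` {p}"

definition tangent :: "'a set \<Rightarrow> 'a set \<Rightarrow> bool"
  where "tangent K L \<longleftrightarrow> (\<exists>y. K \<inter> L = {y})"

definition tangent_pencil :: "'a set set \<Rightarrow> 'a \<Rightarrow> 'a set \<Rightarrow> 'a set set"
  where "tangent_pencil \<C> p K = insert K {L \<in> \<C>. K \<inter> L = {p}}"

definition point_pencil :: "'a set set \<Rightarrow> 'a \<Rightarrow> 'a \<Rightarrow> 'a set set"
  where "point_pencil \<C> x q = {N \<in> \<C>. x \<in> N \<and> q \<in> N}"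

text \<open>
  Permutations of \<open>\<P>\<close> are represented as in \<^const>\<open>BijGroup\<close>, i.e. as bijections of \<open>\<P>\<close> that
  are \<^const>\<open>undefined\<close> outside \<open>\<P>\<close>. The inverse of a permutation is only required to preserve
  circles and generators where it is itself an automorphism, as for members of an
  automorphism group.
\<close>

definition automorphisms :: "'a set \<Rightarrow> 'a set set \<Rightarrow> 'a rel \<Rightarrow> ('a \<Rightarrow> 'a) set"
  where "automorphisms \<P> \<C> par =
    {f \<in> Bij \<P>. (\<forall>K\<in>\<C>. f ` K \<in> \<C>) \<and> (\<forall>G\<in>\<P> // par. f ` G \<in> \<P> // par)}"

definition automorphism_group :: "'a set \<Rightarrow> 'a set set \<Rightarrow> 'a rel \<Rightarrow> ('a \<Rightarrow> 'a) set \<Rightarrow> bool"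
  where "automorphism_group \<P> \<C> par \<Delta> \<longleftrightarrow>
    subgroup \<Delta> (BijGroup \<P>) \<and> \<Delta> \<subseteq> automorphisms \<P> \<C> par"

definition point_stabilizer :: "('a \<Rightarrow> 'a) set \<Rightarrow> 'a \<Rightarrow> ('a \<Rightarrow> 'a) set"
  where "point_stabilizer \<Delta> r = {\<sigma> \<in> \<Delta>. \<sigma> r = r}"

end

theory Submission
  imports Defs
begin

text \<open>
  The circles through \<open>p\<close> and the generators other than that of \<open>p\<close> are the lines of an affine
  plane on the points not parallel to \<open>p\<close>. Call the lines in the pencil \<open>\<langle>p,K\<rangle>\<close> horizontal.
  The model to keep in mind is the real plane, whose circles are the graphs of the functions
  \<open>a t\<^sup>2 + b t + c\<close>: the coefficient \<open>a\<close> names the point on the generator of \<open>p\<close>, where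
  \<open>p\<close> belongs to \<open>a = 0\<close> and \<open>q\<close> to \<open>a = 1\<close>. The horizontal lines are the constants, and
  the maps \<open>(t, y) \<mapsto> (r t + s, r\<^sup>2 y + u)\<close> preserve this generator pointwise. The parabolas
  \<open>t\<^sup>2 + b t\<close> through the origin have their horizontal tangents at \<open>(-b/2, -b\<^sup>2/4)\<close>, that
  is, on the parabola \<open>- t\<^sup>2\<close>, which is itself tangent to a horizontal line at the origin.

  In general, let \<open>H\<close> be the horizontal line through \<open>x\<close>. By conjugation with an element that
  moves a point of \<open>K\<close> to \<open>x\<close>, the stabilizer \<open>\<Delta>\<^sub>x\<close> is transitive on \<open>H - {p, x}\<close>
  (lemma \<open>stabilizer_transitive_on_pencil_circle\<close>). A circle \<open>N\<close> through \<open>x\<close> and \<open>q\<close> either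
  touches \<open>H\<close> in \<open>x\<close>, and then \<open>x\<close> is its point of horizontal tangency, or meets \<open>H\<close>
  in exactly one further point and is determined by that point. As \<open>\<Delta>\<close> fixes \<open>q\<close>,
  the circles of the second kind form a single orbit of \<open>\<Delta>\<^sub>x\<close>, and so do their points of
  horizontal tangency. Let \<open>y\<^sub>1\<close> be one of these points and let \<open>Q\<close> be the circle
  through \<open>y\<^sub>1\<close> that touches \<open>H\<close> in \<open>x\<close>. It is also the unique circle that touches \<open>H\<close>
  in \<open>x\<close> and passes through a certain point of the generator of \<open>p\<close>, which is fixed by
  \<open>\<Delta>\<close>; therefore \<open>\<Delta>\<^sub>x\<close> leaves \<open>Q\<close> invariant (lemma \<open>touching_circle_invariant\<close>) and \<open>Q\<close>
  contains the orbit of \<open>y\<^sub>1\<close>. The orbit is all of \<open>Q\<close> apart from \<open>x\<close> and the point of \<open>Q\<close>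
  parallel to \<open>p\<close>, because \<open>\<Delta>\<^sub>x\<close> permutes the remaining generators transitively and each
  of them meets \<open>Q\<close> only once.
\<close>

section \<open>Incidence in Laguerre planes\<close>

context laguerre_plane
begin

lemma par_sym: "(a, b) \<in> par \<Longrightarrow> (b, a) \<in> par"
  using equiv_par by (meson equivE symD)

lemma par_trans: "(a, b) \<in> par \<Longrightarrow> (b, c) \<in> par \<Longrightarrow> (a, c) \<in> par"
  using equiv_par by (meson equivE transD)

lemma par_refl: "a \<in> \<P> \<Longrightarrow> (a, a) \<in> par"
  using equiv_par by (meson equivE refl_onD)

lemma circle_point_in: "K \<in> \<C> \<Longrightarrow> a \<in> K \<Longrightarrow> a \<in> \<P>"
  using circle_subset by blast

lemma parallel_on_circle_eq:
  assumes "K \<in> \<C>" "a \<in> K" "b \<in> K" "(a, b) \<in> par"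
  shows "a = b"
  using parallel_projection[of a K] par_refl[of a] assms circle_point_in by blast

lemma circle_eqI:
  assumes "K \<in> \<C>" "L \<in> \<C>" "{a, b, c} \<subseteq> K" "{a, b, c} \<subseteq> L" "a \<noteq> b" "b \<noteq> c" "a \<noteq> c"
  shows "K = L"
proof -
  have "(a, b) \<notin> par" "(b, c) \<notin> par" "(a, c) \<notin> par"
    using assms parallel_on_circle_eq by (metis insert_subset)+
  then show ?thesis
    using joining[of a b c] assms circle_point_in by blast
qed

text \<open>
  Parallel projection from the circle with three points given by the richness axiom is injective,
  so every circle has at least three points.
\<close>

lemma circle_third_point:
  assumes "K \<in> \<C>"
  obtains c where "c \<in> K" "c \<noteq> a" "c \<noteq> b"
proof -
  obtain M u v w where M: "M \<in> \<C>" "u \<in> M" "v \<in> M" "w \<in> M" "u \<noteq> v" "v \<noteq> w" "u \<noteq> w"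
    using rich by blast
  obtain u' v' w' where
    K: "u' \<in> K" "v' \<in> K" "w' \<in> K" "(u, u') \<in> par" "(v, v') \<in> par" "(w, w') \<in> par"
    using parallel_projection[OF circle_point_in assms] M by metis
  have "u' \<noteq> v'" "v' \<noteq> w'" "u' \<noteq> w'"
    using M K parallel_on_circle_eq[OF M(1)] par_sym par_trans by metis+
  then show thesis
    using that K by metis
qed

lemma touching_circle_unique:
  assumes "H \<in> \<C>" "a \<in> H" "b \<notin> H" "(a, b) \<notin> par"
    and "L \<in> \<C>" "b \<in> L" "H \<inter> L = {a}"
    and "M \<in> \<C>" "b \<in> M" "H \<inter> M = {a}"
  shows "L = M"
  using touching[of H a b] assms circle_point_in by blast

lemma tangent_pencil_circle:
  assumes "K \<in> \<C>" "L \<in> tangent_pencil \<C> p K"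
  shows "L \<in> \<C>"
  using assms unfolding tangent_pencil_def by blast

lemma tangent_pencil_contact_point:
  assumes "p \<in> K" "L \<in> tangent_pencil \<C> p K"
  shows "p \<in> L"
  using assms unfolding tangent_pencil_def by blast

text \<open>
  This is the uniqueness half of the parallel axiom for the affine plane at \<open>p\<close>. Off \<open>K\<close> it is
  the uniqueness of the circle touching \<open>K\<close> in \<open>p\<close>.
\<close>

lemma tangent_pencil_unique:
  assumes K: "K \<in> \<C>" "p \<in> K"
    and L: "L \<in> tangent_pencil \<C> p K" "a \<in> L"
    and M: "M \<in> tangent_pencil \<C> p K" "a \<in> M"
    and "a \<noteq> p"
  shows "L = M"
proof (cases "a \<in> K")
  case True
  then show ?thesis
    using L M \<open>a \<noteq> p\<close> unfolding tangent_pencil_def by blast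
next
  case False
  have circles: "L \<in> \<C>" "M \<in> \<C>"
    using tangent_pencil_circle[OF K(1)] L M by auto
  have "(p, a) \<notin> par"
    using parallel_on_circle_eq[OF circles(1)] tangent_pencil_contact_point[OF K(2) L(1)] L(2) \<open>a \<noteq> p\<close>
    by metis
  moreover have "K \<inter> L = {p}" "K \<inter> M = {p}"
    using False L M unfolding tangent_pencil_def by auto
  ultimately show ?thesis
    using touching_circle_unique[OF K False] circles L(2) M(2) by blast
qed

end

section \<open>Groups of automorphisms\<close>

context laguerre_plane
begin

lemma automorphism_bij_betw:
  "automorphism_group \<P> \<C> par \<Delta> \<Longrightarrow> \<sigma> \<in> \<Delta> \<Longrightarrow> bij_betw \<sigma> \<P> \<P>"
  unfolding automorphism_group_def automorphisms_def Bij_def by blast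

lemma automorphism_circle:
  "automorphism_group \<P> \<C> par \<Delta> \<Longrightarrow> \<sigma> \<in> \<Delta> \<Longrightarrow> L \<in> \<C> \<Longrightarrow> \<sigma> ` L \<in> \<C>"
  unfolding automorphism_group_def automorphisms_def by blast

lemma automorphism_parallel:
  assumes "automorphism_group \<P> \<C> par \<Delta>" "\<sigma> \<in> \<Delta>" "(a, b) \<in> par"
  shows "(\<sigma> a, \<sigma> b) \<in> par"
proof -
  have "a \<in> \<P>"
    using assms(3) equiv_par by (meson equiv_type mem_Sigma_iff subsetD)
  then have "\<sigma> ` (par `` {a}) \<in> \<P> // par"
    using assms(1,2) quotientI[OF \<open>a \<in> \<P>\<close>, of par]
    unfolding automorphism_group_def automorphisms_def by auto
  moreover have "\<sigma> a \<in> \<sigma> ` (par `` {a})" "\<sigma> b \<in> \<sigma> ` (par `` {a})"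
    using assms(3) par_refl[OF \<open>a \<in> \<P>\<close>] by auto
  ultimately show ?thesis
    using quotient_eq_iff[OF equiv_par] by metis
qed

lemma automorphism_image_Int:
  assumes "automorphism_group \<P> \<C> par \<Delta>" "\<sigma> \<in> \<Delta>" "L \<in> \<C>" "M \<in> \<C>"
  shows "\<sigma> ` (L \<inter> M) = \<sigma> ` L \<inter> \<sigma> ` M"
  using inj_on_image_Int[OF bij_betw_imp_inj_on[OF automorphism_bij_betw]] assms circle_subset
  by metis

lemma automorphism_inverse:
  assumes "automorphism_group \<P> \<C> par \<Delta>" "\<sigma> \<in> \<Delta>"
  obtains \<tau> where "\<tau> \<in> \<Delta>" "\<And>a. a \<in> \<P> \<Longrightarrow> \<tau> (\<sigma> a) = a" "\<And>a. a \<in> \<P> \<Longrightarrow> \<sigma> (\<tau> a) = a"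
proof -
  have sub: "subgroup \<Delta> (BijGroup \<P>)" and bij: "\<sigma> \<in> Bij \<P>"
    using assms unfolding automorphism_group_def automorphisms_def by auto
  define \<tau> where "\<tau> = (\<lambda>a\<in>\<P>. inv_into \<P> \<sigma> a)"
  have "\<tau> \<in> \<Delta>"
    using subgroup.m_inv_closed[OF sub assms(2)] inv_BijGroup[OF bij] unfolding \<tau>_def by simp
  moreover have "\<tau> (\<sigma> a) = a" "\<sigma> (\<tau> a) = a" if "a \<in> \<P>" for a
    using that automorphism_bij_betw[OF assms] unfolding \<tau>_def
    by (auto simp: bij_betw_apply bij_betw_inv_into_left bij_betw_inv_into_right)
  ultimately show thesis
    using that by blast
qed

lemma automorphism_composition:
  assumes "automorphism_group \<P> \<C> par \<Delta>" "\<sigma> \<in> \<Delta>" "\<tau> \<in> \<Delta>"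
  obtains \<rho> where "\<rho> \<in> \<Delta>" "\<And>a. a \<in> \<P> \<Longrightarrow> \<rho> a = \<sigma> (\<tau> a)"
proof -
  have sub: "subgroup \<Delta> (BijGroup \<P>)" and bij: "\<sigma> \<in> Bij \<P>" "\<tau> \<in> Bij \<P>"
    using assms unfolding automorphism_group_def automorphisms_def by auto
  have "compose \<P> \<sigma> \<tau> \<in> \<Delta>"
    using subgroup.m_closed[OF sub assms(2,3)] bij unfolding BijGroup_def by simp
  then show thesis
    using that by (simp add: compose_eq)
qed

text \<open>
  A circle \<open>Q\<close> touching \<open>H\<close> in \<open>x\<close> is determined by \<open>H\<close>, \<open>x\<close> and any further point of \<open>Q\<close>.
  An automorphism that fixes these data therefore fixes \<open>Q\<close>. For a group that fixes every point
  of one generator, the further point can be chosen on that generator.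
\<close>

lemma touching_circle_invariant:
  assumes group: "automorphism_group \<P> \<C> par \<Delta>" "\<sigma> \<in> \<Delta>"
    and "H \<in> \<C>" "Q \<in> \<C>" "H \<inter> Q = {x}" "c \<in> Q" "c \<noteq> x"
    and "\<sigma> ` H = H" "\<sigma> x = x" "\<sigma> c = c"
  shows "\<sigma> ` Q = Q"
proof -
  have "H \<inter> \<sigma> ` Q = {x}"
    using automorphism_image_Int[OF group \<open>H \<in> \<C>\<close> \<open>Q \<in> \<C>\<close>] assms by simp
  moreover have "c \<in> \<sigma> ` Q"
    using assms by (metis imageI)
  moreover have "c \<notin> H" "x \<in> H" "(x, c) \<notin> par"
    using assms parallel_on_circle_eq[OF \<open>Q \<in> \<C>\<close>] by blast+
  ultimately show ?thesis
    using touching_circle_unique[of H x c "\<sigma> ` Q" Q] automorphism_circle[OF group] assms by blast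
qed

text \<open>
  Hypothesis \<open>ii\<close> concerns the circle \<open>K\<close> only. Its conjugate by an element that maps some
  \<open>r \<in> K\<close> to \<open>x\<close> is the same property for the image of \<open>K\<close>, which lies in the pencil because
  the pencil is invariant, and passes through \<open>x\<close>.
\<close>

lemma stabilizer_transitive_on_pencil_circle:
  assumes "K \<in> \<C>" "p \<in> K"
    and group: "automorphism_group \<P> \<C> par \<Delta>"
    and pencil: "\<forall>\<sigma>\<in>\<Delta>. (\<lambda>L. \<sigma> ` L) ` tangent_pencil \<C> p K = tangent_pencil \<C> p K"
    and fixp: "\<forall>\<sigma>\<in>\<Delta>. \<sigma> p = p"
    and i: "\<forall>y\<in>\<P> - generator par p. \<forall>z\<in>\<P> - generator par p. \<exists>\<sigma>\<in>\<Delta>. \<sigma> y = z"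
    and ii: "\<forall>r\<in>K - {p}. \<forall>y\<in>K - {p, r}. \<forall>z\<in>K - {p, r}.
               \<exists>\<sigma>\<in>point_stabilizer \<Delta> r. \<sigma> y = z"
    and x: "x \<in> \<P> - generator par p"
  obtains H where "H \<in> tangent_pencil \<C> p K" "x \<in> H"
    "\<And>y z. y \<in> H - {p, x} \<Longrightarrow> z \<in> H - {p, x} \<Longrightarrow> \<exists>\<sigma>\<in>point_stabilizer \<Delta> x. \<sigma> y = z"
proof -
  obtain r where r: "r \<in> K" "r \<noteq> p"
    using circle_third_point[OF \<open>K \<in> \<C>\<close>, of p p] by blast
  have "r \<in> \<P> - generator par p"
    using r parallel_on_circle_eq[OF \<open>K \<in> \<C>\<close> \<open>p \<in> K\<close>] circle_point_in[OF \<open>K \<in> \<C>\<close>]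
    unfolding generator_def by blast
  then obtain \<tau> where \<tau>: "\<tau> \<in> \<Delta>" "\<tau> r = x"
    using i x by blast
  obtain \<tau>' where \<tau>': "\<tau>' \<in> \<Delta>" "\<And>a. a \<in> \<P> \<Longrightarrow> \<tau>' (\<tau> a) = a"
    using automorphism_inverse[OF group \<tau>(1)] by blast
  show thesis
  proof
    have "K \<in> tangent_pencil \<C> p K"
      unfolding tangent_pencil_def by simp
    then show "\<tau> ` K \<in> tangent_pencil \<C> p K"
      using bspec[OF pencil \<tau>(1)] by (metis imageI)
    show "x \<in> \<tau> ` K"
      using r \<tau> by blast
    have preimage: "\<exists>w0\<in>K - {p, r}. w = \<tau> w0" if "w \<in> \<tau> ` K - {p, x}" for w
      using that fixp \<tau> by (auto intro!: bexI)
    fix y z assume "y \<in> \<tau> ` K - {p, x}" "z \<in> \<tau> ` K - {p, x}"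
    then obtain y0 z0 where
      y0: "y0 \<in> K - {p, r}" "y = \<tau> y0" and z0: "z0 \<in> K - {p, r}" "z = \<tau> z0"
      using preimage by meson
    then obtain \<sigma> where \<sigma>: "\<sigma> \<in> \<Delta>" "\<sigma> r = r" "\<sigma> y0 = z0"
      using ii r unfolding point_stabilizer_def by blast
    obtain \<rho>' where \<rho>': "\<rho>' \<in> \<Delta>" "\<And>a. a \<in> \<P> \<Longrightarrow> \<rho>' a = \<sigma> (\<tau>' a)"
      using automorphism_composition[OF group \<sigma>(1) \<tau>'(1)] by blast
    obtain \<rho> where \<rho>: "\<rho> \<in> \<Delta>" "\<And>a. a \<in> \<P> \<Longrightarrow> \<rho> a = \<tau> (\<rho>' a)"
      using automorphism_composition[OF group \<tau>(1) \<rho>'(1)] by blast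
    have "\<rho> (\<tau> a) = \<tau> (\<sigma> a)" if "a \<in> K" for a
      using that \<rho>(2) \<rho>'(2) \<tau>'(2) circle_point_in[OF \<open>K \<in> \<C>\<close>]
        bij_betw_apply[OF automorphism_bij_betw[OF group \<tau>(1)]] by simp
    then have "\<rho> x = x" "\<rho> y = z"
      using \<tau> \<sigma> r y0 z0 by auto
    then show "\<exists>\<sigma>\<in>point_stabilizer \<Delta> x. \<sigma> y = z"
      using \<rho>(1) unfolding point_stabilizer_def by blast
  qed
qed

end

section \<open>The circle of points of tangency\<close>

theorem theorem4p1:
  fixes \<P> :: "'a set" and \<C> :: "'a set set" and par :: "'a rel"
    and p q x :: 'a and K :: "'a set" and \<Delta> :: "('a \<Rightarrow> 'a) set"
  assumes plane: "laguerre_plane \<P> \<C> par"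
    and "p \<in> \<P>" and "K \<in> \<C>" and "p \<in> K"
    and group: "automorphism_group \<P> \<C> par \<Delta>"
    and pencil: "\<forall>\<sigma>\<in>\<Delta>. (\<lambda>L. \<sigma> ` L) ` tangent_pencil \<C> p K = tangent_pencil \<C> p K"
    and fixes_gen: "\<forall>\<sigma>\<in>\<Delta>. \<forall>z\<in>generator par p. \<sigma> z = z"
    and i: "\<forall>y\<in>\<P> - generator par p. \<forall>z\<in>\<P> - generator par p. \<exists>\<sigma>\<in>\<Delta>. \<sigma> y = z"
    and ii: "\<forall>r\<in>K - {p}. \<forall>y\<in>K - {p, r}. \<forall>z\<in>K - {p, r}.
               \<exists>\<sigma>\<in>point_stabilizer \<Delta> r. \<sigma> y = z"
    and iii: "\<forall>M\<in>\<C>. p \<notin> M \<longrightarrow> (\<exists>!L. L \<in> tangent_pencil \<C> p K \<and> tangent L M)"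
    and "q \<in> \<P>" and "q \<noteq> p" and "(q, p) \<in> par"
    and "x \<in> \<P>" and "(x, p) \<notin> par"
  shows "\<exists>Q\<in>\<C>. {y. \<exists>L\<in>tangent_pencil \<C> p K. \<exists>N\<in>point_pencil \<C> x q. L \<inter> N = {y}}
                 = Q - generator par p"
proof -
  interpret laguerre_plane \<P> \<C> par
    by (fact plane)
  note aut = automorphism_circle[OF group] automorphism_parallel[OF group]
    automorphism_image_Int[OF group]
  have gen: "a \<in> generator par p \<longleftrightarrow> (p, a) \<in> par" for a
    unfolding generator_def by simp
  have fixp: "\<forall>\<sigma>\<in>\<Delta>. \<sigma> p = p" and fixq: "\<forall>\<sigma>\<in>\<Delta>. \<sigma> q = q"
    using fixes_gen par_refl[OF \<open>p \<in> \<P>\<close>] par_sym[OF \<open>(q, p) \<in> par\<close>] by (auto simp: gen)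
  have xp: "(p, x) \<notin> par" "x \<noteq> p"
    using \<open>(x, p) \<notin> par\<close> par_sym par_refl[OF \<open>p \<in> \<P>\<close>] by blast+
  have xq: "(x, q) \<notin> par" "x \<noteq> q"
    using \<open>(x, p) \<notin> par\<close> \<open>(q, p) \<in> par\<close> par_trans by blast+
  have notp: "p \<notin> N" if "N \<in> \<C>" "q \<in> N" for N
    using that parallel_on_circle_eq \<open>(q, p) \<in> par\<close> \<open>q \<noteq> p\<close> by blast
  obtain H where H: "H \<in> tangent_pencil \<C> p K" "x \<in> H"
    and trans: "\<And>y z. y \<in> H - {p, x} \<Longrightarrow> z \<in> H - {p, x} \<Longrightarrow>
      \<exists>\<sigma>\<in>point_stabilizer \<Delta> x. \<sigma> y = z"
    using stabilizer_transitive_on_pencil_circle[OF \<open>K \<in> \<C>\<close> \<open>p \<in> K\<close> group pencil fixp i ii]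
      \<open>x \<in> \<P>\<close> xp by (metis DiffI gen)
  have HC: "H \<in> \<C>" "p \<in> H"
    using tangent_pencil_circle[OF \<open>K \<in> \<C>\<close> H(1)] tangent_pencil_contact_point[OF \<open>p \<in> K\<close> H(1)] by auto
  have pencil': "\<sigma> ` L \<in> tangent_pencil \<C> p K"
    if "\<sigma> \<in> \<Delta>" "L \<in> tangent_pencil \<C> p K" for \<sigma> L
    using pencil that by blast
  have Hinv: "\<sigma> ` H = H" if "\<sigma> \<in> point_stabilizer \<Delta> x" for \<sigma>
  proof (rule tangent_pencil_unique[OF \<open>K \<in> \<C>\<close> \<open>p \<in> K\<close> _ _ H xp(2)])
    show "\<sigma> ` H \<in> tangent_pencil \<C> p K" "x \<in> \<sigma> ` H"
      using that pencil'[OF _ H(1)] H(2) unfolding point_stabilizer_def by force+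
  qed
  have qH: "q \<notin> H"
    using parallel_on_circle_eq[OF HC(1) _ HC(2)] \<open>(q, p) \<in> par\<close> \<open>q \<noteq> p\<close> by blast
  obtain N0 where N0: "N0 \<in> \<C>" "q \<in> N0" "H \<inter> N0 = {x}"
    using touching[OF HC(1) H(2) _ xq(1)] qH \<open>q \<in> \<P>\<close> by blast

  \<comment> \<open>The images of \<open>N1\<close> under the stabilizer of \<open>x\<close> will turn out to be all circles through
    \<open>x\<close> and \<open>q\<close> other than \<open>N0\<close>.\<close>
  obtain z1 where z1: "z1 \<in> H" "z1 \<noteq> p" "z1 \<noteq> x"
    using circle_third_point[OF HC(1), of p x] by blast
  have join: "(x, z) \<notin> par \<and> (z, q) \<notin> par \<and> z \<in> \<P>" if "z \<in> H - {p, x}" for z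
    using that HC H(2) parallel_on_circle_eq[OF HC(1)] circle_point_in[OF HC(1)]
      par_trans[OF _ \<open>(q, p) \<in> par\<close>] by blast
  obtain N1 where N1: "N1 \<in> \<C>" "x \<in> N1" "z1 \<in> N1" "q \<in> N1"
    using joining[of x z1 q] join[of z1] z1 \<open>x \<in> \<P>\<close> \<open>q \<in> \<P>\<close> xq by auto
  have "\<exists>!L. L \<in> tangent_pencil \<C> p K \<and> tangent L N1"
    using iii N1(1) notp[OF N1(1,4)] by simp
  then obtain L1 y1 where L1: "L1 \<in> tangent_pencil \<C> p K" "L1 \<inter> N1 = {y1}"
    unfolding tangent_def by auto
  have L1C: "L1 \<in> \<C>" "p \<in> L1"
    using tangent_pencil_circle[OF \<open>K \<in> \<C>\<close> L1(1)] tangent_pencil_contact_point[OF \<open>p \<in> K\<close> L1(1)]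
    by auto
  have y1: "y1 \<in> L1" "y1 \<in> N1" "y1 \<noteq> p"
    using L1(2) notp[OF N1(1,4)] by auto
  have "L1 \<noteq> H"
    using L1(2) N1 H(2) z1 by (metis IntI singletonD)
  then have y1H: "y1 \<notin> H"
    using tangent_pencil_unique[OF \<open>K \<in> \<C>\<close> \<open>p \<in> K\<close> L1(1) y1(1) H(1) _ y1(3)] by blast
  have xy1: "(x, y1) \<notin> par" and py1: "(p, y1) \<notin> par"
    using parallel_on_circle_eq[OF N1(1,2) y1(2)] y1H H(2)
      parallel_on_circle_eq[OF L1C y1(1)] y1(3) by blast+

  obtain Q where Q: "Q \<in> \<C>" "y1 \<in> Q" "H \<inter> Q = {x}"
    using touching[OF HC(1) H(2) _ xy1] y1H circle_point_in[OF L1C(1) y1(1)] by blast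
  obtain c where c: "c \<in> Q" "(p, c) \<in> par"
    using parallel_projection[OF \<open>p \<in> \<P>\<close> Q(1)] by blast
  have "c \<noteq> x"
    using c xp by blast
  have Qinv: "\<sigma> ` Q = Q" if "\<sigma> \<in> point_stabilizer \<Delta> x" for \<sigma>
  proof (rule touching_circle_invariant[OF group _ HC(1) Q(1,3) c(1) \<open>c \<noteq> x\<close> Hinv[OF that]])
    show "\<sigma> \<in> \<Delta>" "\<sigma> x = x" "\<sigma> c = c"
      using that fixes_gen c(2) unfolding point_stabilizer_def by (auto simp: gen)
  qed

  have moved: "\<sigma> ` L1 \<in> tangent_pencil \<C> p K \<and> \<sigma> ` N1 \<in> point_pencil \<C> x q \<and>
      \<sigma> ` L1 \<inter> \<sigma> ` N1 = {\<sigma> y1}"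
    if "\<sigma> \<in> point_stabilizer \<Delta> x" for \<sigma>
  proof -
    have \<sigma>: "\<sigma> \<in> \<Delta>" "\<sigma> x = x" "\<sigma> q = q"
      using that fixq unfolding point_stabilizer_def by auto
    then have "x \<in> \<sigma> ` N1" "q \<in> \<sigma> ` N1"
      using N1 by (metis imageI)+
    then show ?thesis
      using pencil'[OF \<sigma>(1) L1(1)] aut(1)[OF \<sigma>(1) N1(1)] aut(3)[OF \<sigma>(1) L1C(1) N1(1)] L1(2)
      unfolding point_pencil_def by simp
  qed
  have same_tangent: "L = M"
    if "N \<in> \<C>" "q \<in> N" "L \<in> tangent_pencil \<C> p K" "L \<inter> N = {y}"
      "M \<in> tangent_pencil \<C> p K" "M \<inter> N = {z}" for N L M y z
  proof -
    have "\<exists>!L. L \<in> tangent_pencil \<C> p K \<and> tangent L N"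
      using iii that(1) notp[OF that(1,2)] by simp
    moreover have "tangent L N" "tangent M N"
      using that(4,6) unfolding tangent_def by auto
    ultimately show ?thesis
      using that(3,5) by auto
  qed

  have "{y. \<exists>L\<in>tangent_pencil \<C> p K. \<exists>N\<in>point_pencil \<C> x q. L \<inter> N = {y}}
      = Q - generator par p"
  proof (intro equalityI subsetI)
    fix y assume "y \<in> {y. \<exists>L\<in>tangent_pencil \<C> p K. \<exists>N\<in>point_pencil \<C> x q. L \<inter> N = {y}}"
    then obtain L N where L: "L \<in> tangent_pencil \<C> p K" "L \<inter> N = {y}"
      and N: "N \<in> \<C>" "x \<in> N" "q \<in> N"
      unfolding point_pencil_def by blast
    have "y \<noteq> p"
      using L(2) notp[OF N(1,3)] by blast
    then have "(p, y) \<notin> par"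
      using parallel_on_circle_eq[OF tangent_pencil_circle[OF \<open>K \<in> \<C>\<close> L(1)]
          tangent_pencil_contact_point[OF \<open>p \<in> K\<close> L(1)]] L(2) by blast
    moreover have "y \<in> Q"
    proof (cases "H \<inter> N = {x}")
      case True
      then have "L = H"
        using same_tangent[OF N(1,3) L H(1)] by blast
      then show ?thesis
        using True L(2) Q(3) by blast
    next
      case False
      then obtain z where z: "z \<in> H" "z \<in> N" "z \<noteq> x"
        using H(2) N(2) by blast
      then have zH: "z \<in> H - {p, x}"
        using notp[OF N(1,3)] by blast
      then obtain \<sigma> where \<sigma>: "\<sigma> \<in> point_stabilizer \<Delta> x" "\<sigma> z1 = z"
        using trans z1 by blast
      have "{x, z, q} \<subseteq> \<sigma> ` N1"
        using moved[OF \<sigma>(1)] \<sigma>(2) N1(3) unfolding point_pencil_def by auto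
      then have "\<sigma> ` N1 = N"
        using circle_eqI[of "\<sigma> ` N1" N x z q] moved[OF \<sigma>(1)] N z xq(2) qH
        unfolding point_pencil_def by blast
      then have "L = \<sigma> ` L1"
        using same_tangent[OF N(1,3) L] moved[OF \<sigma>(1)] by blast
      then have "y = \<sigma> y1"
        using L(2) moved[OF \<sigma>(1)] \<open>\<sigma> ` N1 = N\<close> by simp
      then show ?thesis
        using Qinv[OF \<sigma>(1)] Q(2) by blast
    qed
    ultimately show "y \<in> Q - generator par p"
      by (simp add: gen)
  next
    fix y assume "y \<in> Q - generator par p"
    then have y: "y \<in> Q" "(p, y) \<notin> par" "y \<in> \<P>"
      using circle_point_in[OF Q(1)] by (auto simp: gen)
    have "\<exists>L\<in>tangent_pencil \<C> p K. \<exists>N\<in>point_pencil \<C> x q. L \<inter> N = {y}"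
    proof (cases "y = x")
      case True
      then show ?thesis
        using H(1) N0 unfolding point_pencil_def by blast
    next
      case False
      \<comment> \<open>Project \<open>y\<close> and \<open>y1\<close> to \<open>H\<close>. An element of the stabilizer that matches the projections
        maps \<open>y1\<close> to a point of \<open>Q\<close> parallel to \<open>y\<close>.\<close>
      have proj: "\<exists>w. w \<in> H - {p, x} \<and> (u, w) \<in> par" if u: "u \<in> Q" "u \<noteq> x" "(p, u) \<notin> par" for u
      proof -
        obtain w where w: "w \<in> H" "(u, w) \<in> par"
          using parallel_projection[OF circle_point_in[OF Q(1) u(1)] HC(1)] by blast
        have "x \<in> Q"
          using Q(3) by blast
        then have "w \<noteq> p" "w \<noteq> x"
          using w u par_sym parallel_on_circle_eq[OF Q(1)] by blast+
        then show ?thesis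
          using w by blast
      qed
      obtain w w1 where w: "w \<in> H - {p, x}" "(y, w) \<in> par"
        and w1: "w1 \<in> H - {p, x}" "(y1, w1) \<in> par"
        using proj[OF y(1) False y(2)] proj[OF Q(2) _ py1] y1H H(2) by blast
      obtain \<sigma> where \<sigma>: "\<sigma> \<in> point_stabilizer \<Delta> x" "\<sigma> w1 = w"
        using trans[OF w1(1) w(1)] by blast
      then have "(\<sigma> y1, w) \<in> par"
        using aut(2)[OF _ w1(2)] unfolding point_stabilizer_def by blast
      then have "(\<sigma> y1, y) \<in> par"
        using w(2) par_sym par_trans by blast
      moreover have "\<sigma> y1 \<in> Q"
        using Qinv[OF \<sigma>(1)] Q(2) by blast
      ultimately have "\<sigma> y1 = y"
        using parallel_on_circle_eq[OF Q(1)] y(1) by blast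
      then show ?thesis
        using moved[OF \<sigma>(1)] by blast
    qed
    then show "y \<in> {y. \<exists>L\<in>tangent_pencil \<C> p K. \<exists>N\<in>point_pencil \<C> x q. L \<inter> N = {y}}"
      by blast
  qed
  then show ?thesis
    using Q(1) by blast
qed

end
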